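(* Let $C$ be a closed convex cone in $\mathbb{R}^d$. The statistical dimension $\delta(C):=\sum_{k=0}^d k\,v_k(C)$ satisfies $$\delta(C)=\mathbb{E}\big[\|\Pi_C(g)\|^2\big],$$ where $g\in\mathbb{R}^d$ is a standard normal vector, $\|\cdot\|$ is the Euclidean norm, and $\Pi_C$ is the Euclidean projection onto $C$.
   Context: A convex cone in $\mathbb{R}^d$ is a (nonempty) convex set $C$ with $C=\tau C$ for all $\tau>0$. For a closed convex cone $C$, $\Pi_C(x)$ denotes the point of $C$ nearest to $x$ in Euclidean norm. Conic intrinsic volumes: a cone is polyhedral if it is an intersection of finitely many closed halfspaces with the origin on their boundary. For a polyhedral cone $C\subset\mathbb{R}^d$ and $k=0,\dots,d$, $v_k(C) := \mathbb{P}\{\Pi_C(g)$ lies in the relative interior of a $k$-dimensional face of $C\}$. For a general closed convex cone $C$, $v_k(C):=\lim_{i\to\infty} v_k(C_i)$, where $(C_i)$ is any sequence of polyhedral cones converging to $C$ in the conic Hausdorff metric (identify each closed convex cone with its intersection with the unit sphere $\mathsf{S}^{d-1}$ and use the Hausdorff metric on the sphere); the limit does not depend on the sequence. *)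

theory Defs
  imports "HOL-Probability.Probability"
begin

definition closed_convex_cone :: "'a::euclidean_space set \<Rightarrow> bool" where
  "closed_convex_cone C \<longleftrightarrow>
     closed C \<and> C \<noteq> {} \<and> convex C \<and> (\<forall>\<tau>>0. (\<lambda>x. \<tau> *\<^sub>R x) ` C = C)"

definition polyhedral_cone :: "'a::euclidean_space set \<Rightarrow> bool" where
  "polyhedral_cone C \<longleftrightarrow>
     (\<exists>H. finite H \<and> (\<forall>h\<in>H. \<exists>a. a \<noteq> 0 \<and> h = {x. a \<bullet> x \<le> 0}) \<and> C = \<Inter>H)"

definition std_normal_vector_density :: "'a::euclidean_space \<Rightarrow> real" where
  "std_normal_vector_density x = (\<Prod>b\<in>Basis. std_normal_density (x \<bullet> b))"

definition std_normal_vector_distribution :: "'a::euclidean_space measure" where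
  "std_normal_vector_distribution = density lborel (\<lambda>x. ennreal (std_normal_vector_density x))"

(* The library's faces include the empty set; it has aff_dim -1, so it is never
   k-dimensional for a natural number k. *)
definition polyhedral_intrinsic_volume :: "nat \<Rightarrow> 'a::euclidean_space set \<Rightarrow> real" where
  "polyhedral_intrinsic_volume k C =
     measure std_normal_vector_distribution
       {x. \<exists>F. F face_of C \<and> aff_dim F = int k \<and> closest_point C x \<in> rel_interior F}"

(* Values in [0, \<infinity>] give the usual convention for the empty set: distance 0 to itself and
   infinite distance to every nonempty set. *)
definition hausdorff_distance :: "'a::metric_space set \<Rightarrow> 'a set \<Rightarrow> ennreal" where
  "hausdorff_distance A B =
     max (SUP a\<in>A. INF b\<in>B. ennreal (dist a b)) (SUP b\<in>B. INF a\<in>A. ennreal (dist a b))"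

(* The sphere carries the Euclidean (chordal) distance; the geodesic distance would give the
   same convergent sequences. The cone {0} corresponds to the empty subset of the sphere. *)
definition conic_hausdorff_distance ::
  "'a::euclidean_space set \<Rightarrow> 'a set \<Rightarrow> ennreal" where
  "conic_hausdorff_distance C D = hausdorff_distance (C \<inter> sphere 0 1) (D \<inter> sphere 0 1)"

(* For a cone that is not polyhedral, the intrinsic volume is the common limit along all
   sequences of polyhedral cones converging to it. *)
definition intrinsic_volume :: "nat \<Rightarrow> 'a::euclidean_space set \<Rightarrow> real" where
  "intrinsic_volume k C =
     (if polyhedral_cone C then polyhedral_intrinsic_volume k C
      else (THE v. \<forall>D :: nat \<Rightarrow> 'a set.
              (\<forall>i. polyhedral_cone (D i)) \<and> (\<lambda>i. conic_hausdorff_distance (D i) C) \<longlonglongrightarrow> 0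
              \<longrightarrow> (\<lambda>i. polyhedral_intrinsic_volume k (D i)) \<longlonglongrightarrow> v))"

definition statistical_dimension :: "'a::euclidean_space set \<Rightarrow> real" where
  "statistical_dimension C = (\<Sum>k=0..DIM('a). real k * intrinsic_volume k C)"

end

theory Submission
  imports Defs "HOL-Computational_Algebra.Polynomial"
begin

text \<open>For a polyhedral cone, the points projecting into the relative interior of a
  \<open>k\<close>-dimensional face form a region invariant under scaling the span of that face, so a linear change
  of variables gives \<open>E exp (- \<lambda> \<parallel>\<Pi>\<^sub>C(g)\<parallel>\<^sup>2 / 2) = (\<Sum>k. v\<^sub>k(C) t\<^sup>k)\<close> with \<open>t = (1 + \<lambda>) powr (- 1/2)\<close>.
  The left-hand side is continuous in the conic Hausdorff metric, and a polynomial of bounded degree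
  is determined linearly by finitely many values; hence the intrinsic volumes of approximating
  polyhedral cones converge and the identity holds for every closed convex cone. Subtracting from the
  total mass \<open>1\<close>, dividing by \<open>\<lambda> / 2\<close> and letting \<open>\<lambda>\<close> decrease to \<open>0\<close> gives the theorem by
  monotone convergence.\<close>

subsection \<open>Gaussian measure and linear changes of variables\<close>

text \<open>Only the norm enters this closed form: it gives invariance under orthogonal maps, and
  the Pythagorean theorem can split the weight along a face and its orthogonal complement.\<close>

lemma std_normal_vector_density_eq:
  "std_normal_vector_density (x :: 'a::euclidean_space) =
     (1 / sqrt (2 * pi)) ^ DIM('a) * exp (- (norm x)\<^sup>2 / 2)"
proof -
  have "(norm x)\<^sup>2 = (\<Sum>b\<in>Basis. (x \<bullet> b)\<^sup>2)"
    unfolding power2_norm_eq_inner by (subst euclidean_inner) (simp add: power2_eq_square)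
  then have "exp (- (norm x)\<^sup>2 / 2) = (\<Prod>b\<in>Basis. exp (- (x \<bullet> b)\<^sup>2 / 2))"
    by (simp add: sum_negf sum_divide_distrib flip: exp_sum)
  moreover have "std_normal_vector_density x = (\<Prod>b\<in>Basis. 1 / sqrt (2 * pi) * exp (- (x \<bullet> b)\<^sup>2 / 2))"
    by (simp add: std_normal_vector_density_def std_normal_density_def)
  ultimately show ?thesis
    by (simp only: prod.distrib prod_constant)
qed

lemma std_normal_vector_density_pos: "0 < std_normal_vector_density x"
  by (simp add: std_normal_vector_density_eq)

lemma std_normal_vector_density_cong_norm:
  fixes x y :: "'a::euclidean_space"
  shows "norm x = norm y \<Longrightarrow> std_normal_vector_density x = std_normal_vector_density y"
  by (simp add: std_normal_vector_density_eq)

lemma borel_measurable_std_normal_vector_density [measurable]: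
  "std_normal_vector_density \<in> borel_measurable borel"
  unfolding std_normal_vector_density_def by measurable

lemma nn_integral_std_normal_vector_density:
  "(\<integral>\<^sup>+x. ennreal (std_normal_vector_density (x :: 'a::euclidean_space)) \<partial>lborel) = 1"
proof -
  have "(\<integral>\<^sup>+x. ennreal (std_normal_vector_density (x :: 'a)) \<partial>lborel) =
      (\<integral>\<^sup>+x. (\<Prod>b\<in>(Basis :: 'a set). ennreal (std_normal_density (x \<bullet> b))) \<partial>lborel)"
    by (simp add: std_normal_vector_density_def prod_ennreal)
  also have "\<dots> = (\<Prod>b\<in>(Basis :: 'a set). \<integral>\<^sup>+x. ennreal (std_normal_density x) \<partial>lborel)"
    by (rule nn_integral_lborel_prod) auto
  also have "\<dots> = 1"
    by (subst nn_integral_eq_integral) (auto simp: integral_std_normal_moment_even[of 0, simplified])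
  finally show ?thesis .
qed

lemma space_std_normal_vector_distribution [simp]:
  "space std_normal_vector_distribution = UNIV"
  by (simp add: std_normal_vector_distribution_def)

lemma sets_std_normal_vector_distribution [simp, measurable_cong]:
  "sets std_normal_vector_distribution = sets borel"
  by (simp add: std_normal_vector_distribution_def)

lemma prob_space_std_normal_vector_distribution:
  "prob_space (std_normal_vector_distribution :: 'a::euclidean_space measure)"
  by (rule prob_spaceI)
    (simp add: std_normal_vector_distribution_def emeasure_density nn_integral_std_normal_vector_density)

lemma nn_integral_lborel_translate:
  fixes f :: "'a::euclidean_space \<Rightarrow> ennreal"
  assumes [measurable]: "f \<in> borel_measurable borel"
  shows "(\<integral>\<^sup>+x. f (c + x) \<partial>lborel) = (\<integral>\<^sup>+x. f x \<partial>lborel)"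
proof -
  have "(\<integral>\<^sup>+x. f x \<partial>lborel) = (\<integral>\<^sup>+x. f x \<partial>distr lborel borel ((+) c))"
    by (simp add: lborel_distr_plus)
  then show ?thesis by (simp add: nn_integral_distr)
qed

text \<open>Uniqueness of Haar measure by Tonelli: for the even, rotation-invariant Gaussian weight
  \<open>\<gamma>\<close>, both integrals equal the double integral of \<open>f (U x) \<gamma> (y - U x)\<close>.\<close>

lemma nn_integral_lborel_orthogonal:
  fixes f :: "'a::euclidean_space \<Rightarrow> ennreal" and U :: "'a \<Rightarrow> 'a"
  assumes U: "orthogonal_transformation U"
    and [measurable]: "f \<in> borel_measurable borel"
  shows "(\<integral>\<^sup>+x. f (U x) \<partial>lborel) = (\<integral>\<^sup>+x. f x \<partial>lborel)"
proof -
  define \<gamma> :: "'a \<Rightarrow> ennreal" where "\<gamma> x = ennreal (std_normal_vector_density x)" for x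
  have [measurable]: "\<gamma> \<in> borel_measurable borel"
    unfolding \<gamma>_def by measurable
  have lin: "linear U"
    using U by (simp add: orthogonal_transformation_def)
  then have [measurable]: "U \<in> borel_measurable borel"
    by (intro borel_measurable_continuous_onI linear_continuous_on) (simp add: linear_conv_bounded_linear)
  have \<gamma>_cong: "\<gamma> x = \<gamma> y" if "norm x = norm y" for x y :: 'a
    using std_normal_vector_density_cong_norm[OF that] by (simp add: \<gamma>_def)
  have \<gamma>U: "\<gamma> (U x) = \<gamma> x" for x
    by (rule \<gamma>_cong) (rule orthogonal_transformation_norm[OF U])
  have \<gamma>1: "(\<integral>\<^sup>+x. \<gamma> x \<partial>lborel) = 1"
    by (simp add: \<gamma>_def nn_integral_std_normal_vector_density)
  have "(\<integral>\<^sup>+y. f y \<partial>lborel) = (\<integral>\<^sup>+y. f y \<partial>lborel) * (\<integral>\<^sup>+x. \<gamma> (U x) \<partial>lborel)"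
    by (simp add: \<gamma>U \<gamma>1)
  also have "\<dots> = (\<integral>\<^sup>+x. (\<integral>\<^sup>+y. f y \<partial>lborel) * \<gamma> (U x) \<partial>lborel)"
    by (subst nn_integral_cmult) auto
  also have "\<dots> = (\<integral>\<^sup>+x. (\<integral>\<^sup>+y. f (U x + y) \<partial>lborel) * \<gamma> (U x) \<partial>lborel)"
    by (subst nn_integral_lborel_translate) auto
  also have "\<dots> = (\<integral>\<^sup>+x. \<integral>\<^sup>+y. f (U x + y) * \<gamma> (U x) \<partial>lborel \<partial>lborel)"
    by (subst nn_integral_multc) auto
  also have "\<dots> = (\<integral>\<^sup>+y. \<integral>\<^sup>+x. f (U x + y) * \<gamma> (U x) \<partial>lborel \<partial>lborel)"
    by (rule lborel_pair.Fubini'[symmetric]) measurable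
  also have "\<dots> = (\<integral>\<^sup>+y. \<integral>\<^sup>+x. f (U x) * \<gamma> (- U x + y) \<partial>lborel \<partial>lborel)"
  proof (rule nn_integral_cong)
    fix y :: 'a
    \<comment> \<open>Surjectivity turns the shift by \<open>y\<close> into a translation of the
      argument by \<open>z\<close>. Translating back moves the shift from \<open>f\<close> to
      \<open>\<gamma>\<close>, and evenness of \<open>\<gamma>\<close> fixes the sign.\<close>
    obtain z where z: "y = U z"
      using orthogonal_transformation_surj[OF U] by (meson surjD)
    have "(\<integral>\<^sup>+x. f (U x + y) * \<gamma> (U x) \<partial>lborel) =
        (\<integral>\<^sup>+x. f (U (- z + x) + y) * \<gamma> (U (- z + x)) \<partial>lborel)"
      by (rule nn_integral_lborel_translate[symmetric]) measurable
    also have "\<dots> = (\<integral>\<^sup>+x. f (U x) * \<gamma> (- U x + y) \<partial>lborel)"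
      by (intro nn_integral_cong arg_cong2[of _ _ _ _ "(*)"] \<gamma>_cong)
        (simp_all add: z linear_diff[OF lin] norm_minus_commute)
    finally show "(\<integral>\<^sup>+x. f (U x + y) * \<gamma> (U x) \<partial>lborel) = \<dots>" .
  qed
  also have "\<dots> = (\<integral>\<^sup>+x. \<integral>\<^sup>+y. f (U x) * \<gamma> (- U x + y) \<partial>lborel \<partial>lborel)"
    by (rule lborel_pair.Fubini') measurable
  also have "\<dots> = (\<integral>\<^sup>+x. f (U x) \<partial>lborel)"
    by (simp add: nn_integral_cmult nn_integral_lborel_translate \<gamma>1 del: uminus_add_conv_diff)
  finally show ?thesis by (rule sym)
qed

lemma nn_integral_lborel_diagonal:
  fixes f :: "'a::euclidean_space \<Rightarrow> ennreal" and c :: "'a \<Rightarrow> real"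
  assumes [measurable]: "f \<in> borel_measurable borel" and c: "\<And>b. b \<in> Basis \<Longrightarrow> c b \<noteq> 0"
  shows "(\<integral>\<^sup>+x. f x \<partial>lborel) =
    ennreal (\<Prod>b\<in>Basis. \<bar>c b\<bar>) * (\<integral>\<^sup>+x. f (\<Sum>b\<in>Basis. (c b * (x \<bullet> b)) *\<^sub>R b) \<partial>lborel)"
  by (subst lborel_affine_euclidean[of c 0, OF c])
    (auto simp: nn_integral_density nn_integral_distr nn_integral_cmult prod_nonneg)

text \<open>In an orthonormal basis adapted to \<open>L\<close> and its orthogonal complement, the
  required map is diagonal with \<open>dim L\<close> entries \<open>s\<close> and all others 1. The
  orthogonal change of basis preserves Lebesgue measure, so the Jacobian is
  \<open>s ^ dim L\<close>.\<close>

lemma subspace_scaling: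
  fixes L :: "'a::euclidean_space set"
  assumes L: "subspace L" and s: "s > 0"
  obtains T where "linear T" "\<And>p. p \<in> L \<Longrightarrow> T p = s *\<^sub>R p"
    "\<And>w. (\<And>p. p \<in> L \<Longrightarrow> w \<bullet> p = 0) \<Longrightarrow> T w = w"
    "\<And>f. f \<in> borel_measurable borel \<Longrightarrow>
       (\<integral>\<^sup>+x. f x \<partial>lborel) = ennreal (s ^ dim L) * (\<integral>\<^sup>+x. f (T x) \<partial>lborel)"
proof -
  define L' where "L' = {w. \<forall>p\<in>L. orthogonal p w}"
  have L': "subspace L'"
    using subspace_orthogonal_to_vectors[of L] by (simp add: L'_def orthogonal_commute)
  have dims: "dim L + dim L' = DIM('a)"
    using dim_subspace_orthogonal_to_vectors[OF L subspace_UNIV] by (simp add: L'_def)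
  obtain B where B: "B \<subseteq> L" "pairwise orthogonal B" "\<And>x. x \<in> B \<Longrightarrow> norm x = 1"
      "independent B" "card B = dim L" "span B = L"
    by (rule orthonormal_basis_subspace[OF L]) auto
  obtain B' where B': "B' \<subseteq> L'" "pairwise orthogonal B'" "\<And>x. x \<in> B' \<Longrightarrow> norm x = 1"
      "independent B'" "card B' = dim L'" "span B' = L'"
    by (rule orthonormal_basis_subspace[OF L']) auto
  have fin: "finite B" "finite B'"
    using B(4) B'(4) by (auto intro: independent_imp_finite)
  have BB': "v \<bullet> w = 0" "w \<bullet> v = 0" if "v \<in> B" "w \<in> B'" for v w
    using that B(1) B'(1) unfolding L'_def orthogonal_def by (metis (mono_tags, lifting) mem_Collect_eq subsetD inner_commute)+
  have disj: "B \<inter> B' = {}"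
    using BB' B(3) by (fastforce simp: norm_eq_1)
  define E where "E = B \<union> B'"
  have E: "finite E" "card E = DIM('a)"
    using fin disj B(5) B'(5) dims by (auto simp: E_def card_Un_disjoint)
  have E1: "v \<bullet> v = 1" if "v \<in> E" for v
    using that B(3) B'(3) by (auto simp: E_def norm_eq_1)
  have E0: "v \<bullet> w = 0" if "v \<in> E" "w \<in> E" "v \<noteq> w" for v w
    using that B(2) B'(2) BB' by (auto simp: E_def pairwise_def orthogonal_def)
  obtain \<beta> where \<beta>: "bij_betw \<beta> (Basis :: 'a set) E"
    using finite_same_card_bij[of Basis E] E by auto
  have \<beta>E: "\<beta> b \<in> E" if "b \<in> Basis" for b
    using \<beta> that by (auto simp: bij_betw_def)
  have \<beta>_inner: "\<beta> b \<bullet> \<beta> b' = (if b = b' then 1 else 0)" if "b \<in> Basis" "b' \<in> Basis" for b b'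
    using that E1 E0 \<beta>E inj_onD[OF bij_betw_imp_inj_on[OF \<beta>], of b b'] by auto
  \<comment> \<open>\<open>U\<close> carries the standard basis to the adapted basis
    \<open>E\<close> along the bijection \<open>\<beta>\<close>.\<close>
  define U :: "'a \<Rightarrow> 'a" where "U y = (\<Sum>b\<in>Basis. (y \<bullet> b) *\<^sub>R \<beta> b)" for y
  have U_inner: "U y \<bullet> \<beta> b = y \<bullet> b" if "b \<in> Basis" for y b
    using that by (simp add: U_def inner_sum_left \<beta>_inner if_distrib cong: if_cong)
  have linU: "linear U"
    unfolding U_def by (intro linear_compose_sum ballI linear_compose_scale_right linearI)
      (auto simp: inner_add_left scaleR_add_left algebra_simps)
  have U: "orthogonal_transformation U"
    unfolding orthogonal_transformation_def
  proof (intro conjI allI linU)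
    fix v w
    have "U v \<bullet> U w = (\<Sum>b\<in>Basis. (w \<bullet> b) * (U v \<bullet> \<beta> b))"
      by (subst (2) U_def) (simp add: inner_sum_right)
    also have "\<dots> = v \<bullet> w"
      by (subst euclidean_inner[of v w]) (simp add: U_inner mult.commute)
    finally show "U v \<bullet> U w = v \<bullet> w" .
  qed
  define c where "c v = (if v \<in> B then s else 1)" for v
  define T where "T x = (\<Sum>v\<in>E. (c v * (x \<bullet> v)) *\<^sub>R v)" for x
  have linT: "linear T"
    unfolding T_def by (intro linear_compose_sum ballI linearI)
      (auto simp: inner_add_left scaleR_add_left algebra_simps)
  have T_basis: "T v = c v *\<^sub>R v" if "v \<in> E" for v
  proof -
    have "T v = (\<Sum>w\<in>E. if w = v then c v *\<^sub>R v else 0)"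
      unfolding T_def using that by (intro sum.cong) (auto simp: E0 E1)
    then show ?thesis using that E by simp
  qed
  have TL: "T p = s *\<^sub>R p" if "p \<in> L" for p
  proof (rule linear_eq_on_span[of T "\<lambda>p. s *\<^sub>R p" B])
    show "linear ((*\<^sub>R) s :: 'a \<Rightarrow> 'a)" by (simp add: linear_scaleR)
  qed (use that B(6) linT T_basis in \<open>auto simp: c_def E_def\<close>)
  have TL': "T w = w" if "\<And>p. p \<in> L \<Longrightarrow> w \<bullet> p = 0" for w
  proof (rule linear_eq_on_span[of T "\<lambda>w. w" B'])
    show "w \<in> span B'"
      using that by (auto simp: B'(6) L'_def orthogonal_def inner_commute)
  qed (use linT T_basis disj in \<open>auto simp: c_def E_def linear_ident\<close>)
  have int: "(\<integral>\<^sup>+x. f x \<partial>lborel) = ennreal (s ^ dim L) * (\<integral>\<^sup>+x. f (T x) \<partial>lborel)"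
    if [measurable]: "f \<in> borel_measurable borel" for f
  proof -
    have [measurable]: "U \<in> borel_measurable borel" "T \<in> borel_measurable borel"
      using linU linT
      by (auto intro!: borel_measurable_continuous_onI linear_continuous_on simp: linear_conv_bounded_linear)
    \<comment> \<open>Conjugation by \<open>U\<close> makes \<open>T\<close> diagonal in the
      standard basis, where \<open>nn_integral_lborel_diagonal\<close> applies; the substitution by
      \<open>U\<close> is undone afterwards.\<close>
    have TU: "T (U y) = U (\<Sum>b\<in>Basis. (c (\<beta> b) * (y \<bullet> b)) *\<^sub>R b)" for y
    proof -
      have "T (U y) = (\<Sum>b\<in>Basis. (c (\<beta> b) * (U y \<bullet> \<beta> b)) *\<^sub>R \<beta> b)"
        unfolding T_def by (rule sum.reindex_bij_betw[OF \<beta>, symmetric])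
      also have "\<dots> = U (\<Sum>b\<in>Basis. (c (\<beta> b) * (y \<bullet> b)) *\<^sub>R b)"
        unfolding U_def[of "sum _ _"] by (intro sum.cong) (auto simp: U_inner)
      finally show ?thesis .
    qed
    have "(\<Prod>b\<in>Basis. \<bar>c (\<beta> b)\<bar>) = (\<Prod>v\<in>E. c v)"
      using s by (subst prod.reindex_bij_betw[OF \<beta>, symmetric]) (auto simp: c_def intro!: prod.cong)
    also have "\<dots> = (\<Prod>v\<in>B. c v) * (\<Prod>v\<in>B'. c v)"
      unfolding E_def using disj fin by (intro prod.union_disjoint) auto
    also have "(\<Prod>v\<in>B. c v) = s ^ dim L"
      by (simp add: c_def B(5))
    also have "(\<Prod>v\<in>B'. c v) = 1"
      using disj by (intro prod.neutral) (auto simp: c_def)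
    finally have prod: "(\<Prod>b\<in>Basis. \<bar>c (\<beta> b)\<bar>) = s ^ dim L"
      by simp
    have "(\<integral>\<^sup>+x. f x \<partial>lborel) = (\<integral>\<^sup>+x. f (U x) \<partial>lborel)"
      by (rule nn_integral_lborel_orthogonal[OF U, symmetric]) measurable
    also have "\<dots> = ennreal (\<Prod>b\<in>Basis. \<bar>c (\<beta> b)\<bar>) *
        (\<integral>\<^sup>+y. f (U (\<Sum>b\<in>Basis. (c (\<beta> b) * (y \<bullet> b)) *\<^sub>R b)) \<partial>lborel)"
      by (rule nn_integral_lborel_diagonal) (use s in \<open>auto simp: c_def\<close>)
    also have "\<dots> = ennreal (s ^ dim L) * (\<integral>\<^sup>+x. f (T (U x)) \<partial>lborel)"
      by (simp only: prod TU)
    also have "(\<integral>\<^sup>+x. f (T (U x)) \<partial>lborel) = (\<integral>\<^sup>+x. f (T x) \<partial>lborel)"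
      by (rule nn_integral_lborel_orthogonal[OF U]) measurable
    finally show ?thesis .
  qed
  show ?thesis
    using that[OF linT TL TL' int] by blast
qed

subsection \<open>Projections onto closed convex cones and polyhedral approximation\<close>

lemma closed_convex_coneD:
  assumes "closed_convex_cone C"
  shows "closed C" "convex C" "C \<noteq> {}" "0 \<in> C" "conic C"
proof -
  from assms show C: "closed C" "convex C" "C \<noteq> {}"
    by (auto simp: closed_convex_cone_def)
  have scale: "\<tau> *\<^sub>R x \<in> C" if "x \<in> C" "\<tau> > 0" for x \<tau>
    using assms that by (auto simp: closed_convex_cone_def)
  show 0: "0 \<in> C"
  proof -
    obtain x where x: "x \<in> C" using C by auto
    \<comment> \<open>The definition scales by positive factors only, so the origin is reached as a
      limit of shrinking multiples of a point.\<close>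
    have "(\<lambda>n. inverse (real (Suc n)) *\<^sub>R x) \<longlonglongrightarrow> 0 *\<^sub>R x"
      by (intro tendsto_scaleR LIMSEQ_inverse_real_of_nat tendsto_const)
    then show ?thesis
      using C(1) scale[OF x] by (intro Lim_in_closed_set[of C _ sequentially "0"]) (auto intro!: always_eventually)
  qed
  show "conic C"
    unfolding conic_def using scale 0 by (metis less_eq_real_def scaleR_zero_left)
qed

lemma closed_convex_coneI:
  assumes "closed C" "convex C" "0 \<in> C" "conic C"
  shows "closed_convex_cone C"
  unfolding closed_convex_cone_def
proof (intro conjI allI impI)
  fix \<tau> :: real assume \<tau>: "\<tau> > 0"
  have "x \<in> (\<lambda>x. \<tau> *\<^sub>R x) ` C" if "x \<in> C" for x
    using that assms(4) \<tau> by (intro image_eqI[of _ _ "(1 / \<tau>) *\<^sub>R x"]) (auto simp: conic_def)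
  then show "(\<lambda>x. \<tau> *\<^sub>R x) ` C = C"
    using assms(4) \<tau> by (auto simp: conic_def)
qed (use assms in auto)

lemma polyhedral_cone_imp_closed_convex_cone:
  assumes "polyhedral_cone C"
  shows "closed_convex_cone C"
proof -
  obtain H where H: "C = \<Inter>H" "\<And>h. h \<in> H \<Longrightarrow> \<exists>a. a \<noteq> 0 \<and> h = {x. a \<bullet> x \<le> 0}"
    using assms by (auto simp: polyhedral_cone_def)
  have h: "closed h \<and> convex h \<and> 0 \<in> h \<and> conic h" if "h \<in> H" for h
    using H(2)[OF that]
    by (auto simp: closed_halfspace_le convex_halfspace_le conic_def mult_nonneg_nonpos)
  show ?thesis
  proof (rule closed_convex_coneI)
    show "closed C" "convex C"
      unfolding H(1) using h by (auto intro!: closed_Inter convex_Inter)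
    show "0 \<in> C"
      unfolding H(1) using h by blast
    show "conic C"
      unfolding H(1) conic_def using h conic_mul by blast
  qed
qed

lemma polyhedral_cone_imp_polyhedron:
  assumes "polyhedral_cone C"
  shows "polyhedron C"
proof -
  obtain H where H: "finite H" "C = \<Inter>H" "\<And>h. h \<in> H \<Longrightarrow> \<exists>a. a \<noteq> 0 \<and> h = {x. a \<bullet> x \<le> 0}"
    using assms by (auto simp: polyhedral_cone_def)
  have "polyhedron h" if "h \<in> H" for h
    using H(3)[OF that] polyhedron_halfspace_le by blast
  with H(1,2) show ?thesis by blast
qed

text \<open>Sufficiency in Moreau's characterisation of the projection: expanding the square of
  \<open>x - y\<close> around \<open>p\<close> leaves a nonnegative square and a cross term whose
  sign the hypotheses fix.\<close>

lemma closest_point_cone_unique: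
  assumes C: "closed_convex_cone C" and p: "p \<in> C" "(x - p) \<bullet> p = 0"
    and polar: "\<And>y. y \<in> C \<Longrightarrow> (x - p) \<bullet> y \<le> 0"
  shows "closest_point C x = p"
proof -
  have "dist x p \<le> dist x y" if "y \<in> C" for y
  proof -
    have "(x - p) \<bullet> (x - p) \<le> (x - y) \<bullet> (x - y)"
      using polar[OF that] p(2) inner_ge_zero[of "p - y"]
      by (simp add: algebra_simps inner_commute)
    then show ?thesis
      by (simp add: dist_norm norm_le)
  qed
  with closed_convex_coneD[OF C] p(1) show ?thesis
    using closest_point_unique[of C p x] by auto
qed

lemma closest_point_cone:
  assumes C: "closed_convex_cone C"
  shows "closest_point C x \<in> C"
    and "(x - closest_point C x) \<bullet> closest_point C x = 0"
    and "y \<in> C \<Longrightarrow> (x - closest_point C x) \<bullet> y \<le> 0"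
    and "x \<bullet> closest_point C x = (norm (closest_point C x))\<^sup>2"
    and "norm (closest_point C x) \<le> norm x"
proof -
  note D = closed_convex_coneD[OF C]
  define p where "p = closest_point C x"
  show p: "closest_point C x \<in> C"
    by (simp add: D closest_point_in_set)
  have dot: "(x - p) \<bullet> (y - p) \<le> 0" if "y \<in> C" for y
    unfolding p_def using that D by (intro closest_point_dot) auto
  \<comment> \<open>Testing the variational inequality at the origin and at twice \<open>p\<close>,
    both in the cone, bounds the inner product with \<open>p\<close> from both sides.\<close>
  have "(x - p) \<bullet> (0 - p) \<le> 0" "(x - p) \<bullet> (2 *\<^sub>R p - p) \<le> 0"
    by (rule dot; use D p in \<open>simp add: conic_def p_def\<close>)+
  then show *: "(x - closest_point C x) \<bullet> closest_point C x = 0"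
    by (simp add: p_def algebra_simps)
  show "(x - closest_point C x) \<bullet> y \<le> 0" if "y \<in> C"
    using dot[OF that] * by (simp add: p_def inner_diff_right)
  show n: "x \<bullet> closest_point C x = (norm (closest_point C x))\<^sup>2"
    using * by (simp add: inner_diff_left power2_norm_eq_inner)
  show "norm (closest_point C x) \<le> norm x"
    using norm_cauchy_schwarz[of x "closest_point C x"] n
    by (cases "closest_point C x = 0") (auto simp: power2_eq_square)
qed

lemma borel_measurable_closest_point:
  assumes "closed_convex_cone C"
  shows "closest_point C \<in> borel_measurable borel"
  using closed_convex_coneD[OF assms]
  by (intro borel_measurable_continuous_onI continuous_on_closest_point)

section \<open>Continuity of the projection norm in the conic Hausdorff metric\<close>

text \<open>Strictness turns a bound on an infimum into a witness. Over an empty set the infimum is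
  infinite, so the bound rules out that case too.\<close>

lemma hausdorff_distance_less_ex:
  assumes "hausdorff_distance A B < ennreal e"
  shows "a \<in> A \<Longrightarrow> \<exists>b\<in>B. dist a b < e" and "b \<in> B \<Longrightarrow> \<exists>a\<in>A. dist a b < e"
proof -
  have *: "(SUP a\<in>A. INF b\<in>B. ennreal (dist a b)) < ennreal e"
      "(SUP b\<in>B. INF a\<in>A. ennreal (dist a b)) < ennreal e"
    using assms by (auto simp: hausdorff_distance_def)
  show "\<exists>b\<in>B. dist a b < e" if "a \<in> A"
    using le_less_trans[OF SUP_upper[OF that] *(1)]
    by (auto simp: INF_less_iff ennreal_less_iff)
  show "\<exists>a\<in>A. dist a b < e" if "b \<in> B"
    using le_less_trans[OF SUP_upper[OF that] *(2)]
    by (auto simp: INF_less_iff ennreal_less_iff)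
qed

text \<open>The norm of the projection onto \<open>C\<close> is \<open>x \<bullet> u\<close> for the
  unit vector \<open>u\<close> in its direction. Replacing \<open>u\<close> by a nearby
  \<open>v\<close> in \<open>D\<close> costs at most \<open>e * norm x\<close>, and
  \<open>x \<bullet> v\<close> is at most the norm of the projection onto \<open>D\<close>.\<close>

lemma norm_closest_point_cone_le:
  assumes C: "closed_convex_cone C" and D: "closed_convex_cone D" and e: "e \<ge> 0"
    and near: "\<And>u. u \<in> C \<inter> sphere 0 1 \<Longrightarrow> \<exists>v\<in>D \<inter> sphere 0 1. dist u v < e"
  shows "norm (closest_point C x) \<le> norm (closest_point D x) + e * norm x"
proof (cases "closest_point C x = 0")
  case False
  define u where "u = closest_point C x /\<^sub>R norm (closest_point C x)"
  have u: "u \<in> C" "norm u = 1"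
    using False closest_point_cone(1)[OF C, of x] closed_convex_coneD(5)[OF C]
    by (auto simp: u_def conic_def)
  then obtain v where v: "v \<in> D" "norm v = 1" "dist u v < e"
    using near[of u] by auto
  have "norm (closest_point C x) = x \<bullet> u"
    using False by (simp add: u_def closest_point_cone(4)[OF C] power2_eq_square)
  also have "\<dots> = (x - closest_point D x) \<bullet> v + closest_point D x \<bullet> v + x \<bullet> (u - v)"
    by (simp add: algebra_simps)
  also have "\<dots> \<le> closest_point D x \<bullet> v + x \<bullet> (u - v)"
    using closest_point_cone(3)[OF D v(1)] by simp
  also have "\<dots> \<le> norm (closest_point D x) + norm x * e"
    using norm_cauchy_schwarz[of "closest_point D x" v] norm_cauchy_schwarz[of x "u - v"] v
      mult_left_mono[of "norm (u - v)" e "norm x"]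
    by (simp add: dist_norm)
  finally show ?thesis by (simp add: mult.commute)
qed (use e in simp)

lemma norm_closest_point_cone_tendsto:
  assumes C: "closed_convex_cone C" and D: "\<And>i::nat. closed_convex_cone (D i)"
    and lim: "(\<lambda>i. conic_hausdorff_distance (D i) C) \<longlonglongrightarrow> 0"
  shows "(\<lambda>i. norm (closest_point (D i) x)) \<longlonglongrightarrow> norm (closest_point C x)"
proof (rule tendstoI)
  fix r :: real assume r: "r > 0"
  \<comment> \<open>The summand 1 covers \<open>x = 0\<close> and makes
    \<open>e * norm x < r\<close> strict.\<close>
  define e where "e = r / (norm x + 1)"
  have e: "e > 0" "e * norm x < r"
    using r add_nonneg_pos[OF norm_ge_zero zero_less_one, of x]
    by (simp_all add: e_def pos_divide_less_eq distrib_left add.commute)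
  have "\<forall>\<^sub>F i in sequentially. conic_hausdorff_distance (D i) C < ennreal e"
    using lim e(1) by (intro order_tendstoD(2)) auto
  then show "\<forall>\<^sub>F i in sequentially. dist (norm (closest_point (D i) x)) (norm (closest_point C x)) < r"
  proof eventually_elim
    case (elim i)
    note near = hausdorff_distance_less_ex[OF elim[unfolded conic_hausdorff_distance_def]]
    have "norm (closest_point (D i) x) \<le> norm (closest_point C x) + e * norm x"
      using e near(1) by (intro norm_closest_point_cone_le C D) auto
    moreover have "norm (closest_point C x) \<le> norm (closest_point (D i) x) + e * norm x"
      using e near(2) by (intro norm_closest_point_cone_le C D) (auto simp: dist_commute)
    ultimately show ?case
      using e(2) by (simp add: dist_real_def)
  qed
qed

section \<open>Polyhedral approximation from outside\<close>

text \<open>\<open>D\<close> is cut out by a finite \<open>e\<close>-net \<open>K\<close> of the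
  compact set \<open>P\<close> of unit polar vectors. For a unit \<open>u\<close> in
  \<open>D\<close>, the direction of its residual lies in \<open>P\<close>, and a net point near it
  has nonpositive product with \<open>u\<close>, so the residual has length at most
  \<open>e\<close>. Normalising the projection costs another \<open>e\<close>.\<close>

lemma polar_cone_approximation:
  fixes C :: "'a::euclidean_space set"
  assumes C: "closed_convex_cone C" and e: "0 < e" "e < 1"
  obtains D where "polyhedral_cone D" "C \<subseteq> D"
    "\<And>u. u \<in> D \<inter> sphere 0 1 \<Longrightarrow> \<exists>v\<in>C \<inter> sphere 0 1. dist u v \<le> 2 * e"
proof -
  define P where "P = {a \<in> sphere 0 1. \<forall>y\<in>C. a \<bullet> y \<le> 0}"
  have "P = sphere 0 1 \<inter> (\<Inter>y\<in>C. {a. y \<bullet> a \<le> 0})"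
    by (auto simp: P_def inner_commute)
  then have "compact P"
    by (auto intro!: compact_Int_closed closed_INT closed_halfspace_le)
  then obtain K where K: "finite K" "K \<subseteq> P" "P \<subseteq> (\<Union>a\<in>K. ball a e)"
    using e seq_compact_imp_totally_bounded[of P] by (auto simp: compact_imp_seq_compact)
  define D where "D = \<Inter>((\<lambda>a. {x. a \<bullet> x \<le> 0}) ` K)"
  have "a \<noteq> 0" if "a \<in> K" for a
    using that K(2) by (auto simp: P_def)
  then have poly: "polyhedral_cone D"
    unfolding polyhedral_cone_def D_def using K(1)
    by (intro exI[of _ "(\<lambda>a. {x. a \<bullet> x \<le> 0}) ` K"]) auto
  have sub: "C \<subseteq> D"
    using K(2) by (auto simp: D_def P_def)
  have "\<exists>v\<in>C \<inter> sphere 0 1. dist u v \<le> 2 * e" if u: "u \<in> D" "norm u = 1" for u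
  proof -
    define p where "p = closest_point C u"
    note p = closest_point_cone[OF C, where x = u, folded p_def]
    have up: "norm (u - p) \<le> e"
    proof (cases "u = p")
      case False
      define a where "a = (u - p) /\<^sub>R norm (u - p)"
      have "a \<in> P"
        using False p(3) by (auto simp: P_def a_def mult_nonneg_nonpos)
      then obtain a' where a': "a' \<in> K" "dist a' a < e"
        using K(3) by auto
      have "norm (u - p) = a \<bullet> u"
      proof -
        have "(u - p) \<bullet> u = (norm (u - p))\<^sup>2"
          using p(2) by (simp add: power2_norm_eq_inner inner_diff_right)
        then show ?thesis
          using False by (simp add: a_def power2_eq_square)
      qed
      also have "\<dots> = a' \<bullet> u + (a - a') \<bullet> u"
        by (simp add: algebra_simps)
      also have "\<dots> \<le> norm (a - a') * norm u"
        using a'(1) u(1) norm_cauchy_schwarz[of "a - a'" u] by (force simp: D_def)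
      also have "\<dots> \<le> e"
        using a'(2) u(2) by (simp add: dist_norm norm_minus_commute)
      finally show ?thesis .
    qed (use e in simp)
    \<comment> \<open>Since \<open>e < 1\<close>, this keeps \<open>p\<close> away from the origin,
      so that it can be normalised.\<close>
    have np: "1 - e \<le> norm p" "norm p \<le> 1"
      using up u(2) norm_triangle_ineq2[of u p] p(5) by auto
    then have p0: "p \<noteq> 0"
      using e by auto
    have "p /\<^sub>R norm p \<in> C \<inter> sphere 0 1"
      using p0 p(1) closed_convex_coneD(5)[OF C] by (auto simp: conic_def)
    moreover have "dist u (p /\<^sub>R norm p) \<le> 2 * e"
    proof -
      have "norm (p - p /\<^sub>R norm p) = norm ((1 - 1 / norm p) *\<^sub>R p)"
        by (simp add: algebra_simps divide_inverse)
      also have "\<dots> = \<bar>norm p - 1\<bar>"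
      proof -
        have "(1 - 1 / norm p) * norm p = norm p - 1"
          using p0 by (simp add: left_diff_distrib)
        then show ?thesis
          by (metis abs_mult abs_norm_cancel norm_scaleR)
      qed
      also have "\<dots> \<le> e" using np by auto
      finally show ?thesis
        using up norm_triangle_ineq[of "u - p" "p - p /\<^sub>R norm p"] by (simp add: dist_norm)
    qed
    ultimately show ?thesis by blast
  qed
  then show ?thesis
    using that[OF poly sub] by auto
qed

lemma polyhedral_approximation:
  fixes C :: "'a::euclidean_space set"
  assumes C: "closed_convex_cone C"
  obtains D :: "nat \<Rightarrow> 'a set"
  where "\<And>i. polyhedral_cone (D i)" "(\<lambda>i. conic_hausdorff_distance (D i) C) \<longlonglongrightarrow> 0"
proof -
  \<comment> \<open>The double successor keeps \<open>e i\<close> below 1 already at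
    \<open>i = 0\<close>, as \<open>polar_cone_approximation\<close> demands.\<close>
  define e where "e i = inverse (real (Suc (Suc i)))" for i
  have e: "0 < e i" "e i < 1" for i
    by (auto simp: e_def field_simps)
  have "\<exists>D. polyhedral_cone D \<and> C \<subseteq> D \<and>
      (\<forall>u \<in> D \<inter> sphere 0 1. \<exists>v\<in>C \<inter> sphere 0 1. dist u v \<le> 2 * e i)" for i
    using polar_cone_approximation[OF C e[of i]] by metis
  then obtain D where D: "\<And>i. polyhedral_cone (D i)" "\<And>i. C \<subseteq> D i"
      "\<And>i u. u \<in> D i \<inter> sphere 0 1 \<Longrightarrow> \<exists>v\<in>C \<inter> sphere 0 1. dist u v \<le> 2 * e i"
    by metis
  have "conic_hausdorff_distance (D i) C \<le> ennreal (2 * e i)" for i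
    unfolding conic_hausdorff_distance_def hausdorff_distance_def
  proof (intro max.boundedI SUP_least)
    fix u assume "u \<in> D i \<inter> sphere 0 1"
    then obtain v where "v \<in> C \<inter> sphere 0 1" "dist u v \<le> 2 * e i"
      using D(3) by metis
    then show "(INF b\<in>C \<inter> sphere 0 1. ennreal (dist u b)) \<le> ennreal (2 * e i)"
      by (intro INF_lower2[of v]) (auto intro: ennreal_leI)
  next
    fix v assume "v \<in> C \<inter> sphere 0 1"
    then show "(INF a\<in>D i \<inter> sphere 0 1. ennreal (dist a v)) \<le> ennreal (2 * e i)"
      using D(2)[of i] by (intro INF_lower2[of v]) auto
  qed
  moreover have "(\<lambda>i. ennreal (2 * e i)) \<longlonglongrightarrow> 0"
  proof -
    have "e \<longlonglongrightarrow> 0"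
      unfolding e_def by (rule LIMSEQ_Suc[OF LIMSEQ_inverse_real_of_nat])
    from tendsto_ennrealI[OF tendsto_mult_right_zero[OF this, of 2]] show ?thesis
      by simp
  qed
  ultimately have "(\<lambda>i. conic_hausdorff_distance (D i) C) \<longlonglongrightarrow> 0"
    using tendsto_sandwich[OF _ _ tendsto_const] by (metis (no_types, lifting) always_eventually zero_le)
  with D(1) show ?thesis by (rule that)
qed

text \<open>The smallest face containing \<open>p\<close> works: if \<open>p\<close> were on its
  relative boundary, a supporting hyperplane at \<open>p\<close> would cut out a strictly smaller
  face through \<open>p\<close>.\<close>

lemma ex_face_of_rel_interior:
  fixes S :: "'a::euclidean_space set"
  assumes S: "convex S" and p: "p \<in> S"
  obtains F where "F face_of S" "p \<in> rel_interior F"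
proof -
  define F where "F = \<Inter>{F. F face_of S \<and> p \<in> F}"
  have F: "F face_of S" "p \<in> F"
    using S p by (auto simp: F_def face_of_refl intro!: face_of_Inter)
  have conv: "convex F"
    using F(1) by (rule face_of_imp_convex)
  have "p \<in> rel_interior F"
  proof (rule ccontr)
    assume "p \<notin> rel_interior F"
    then obtain a where a: "\<And>y. y \<in> F \<Longrightarrow> a \<bullet> p \<le> a \<bullet> y"
        "\<And>y. y \<in> rel_interior F \<Longrightarrow> a \<bullet> p < a \<bullet> y"
      using supporting_hyperplane_rel_boundary[OF conv F(2)] by metis
    have "F \<inter> {x. a \<bullet> x = a \<bullet> p} face_of F"
      using conv a(1) by (intro face_of_Int_supporting_hyperplane_ge) auto
    then have "F \<inter> {x. a \<bullet> x = a \<bullet> p} face_of S"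
      using F(1) by (rule face_of_trans)
    then have "F \<subseteq> {x. a \<bullet> x = a \<bullet> p}"
      using F(2) unfolding F_def by blast
    moreover obtain y where "y \<in> rel_interior F"
      using F(2) conv rel_interior_eq_empty by blast
    ultimately show False
      using a(2)[of y] rel_interior_subset by fastforce
  qed
  with F(1) show ?thesis by (rule that)
qed

subsection \<open>Regions projecting onto a face\<close>

text \<open>A nonempty face contains the origin, so its affine dimension is the dimension of its
  span, the exponent in the scaling Jacobian.\<close>

lemma face_of_closed_convex_cone:
  fixes C :: "'a::euclidean_space set"
  assumes C: "closed_convex_cone C" and F: "F face_of C" and ne: "F \<noteq> {}"
  shows "conic F" "0 \<in> F" "aff_dim F = int (dim F)"
proof -
  show "conic F"
    using face_of_conic[OF closed_convex_coneD(5)[OF C] F] .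
  then show "0 \<in> F"
    using ne by (simp add: conic_contains_0)
  then show "aff_dim F = int (dim F)"
    by (intro aff_dim_zero hull_inc)
qed

lemma borel_rel_interior:
  fixes F :: "'a::euclidean_space set"
  shows "rel_interior F \<in> sets borel"
proof -
  obtain T where "open T" "rel_interior F = affine hull F \<inter> T"
    using openin_rel_interior[of F] by (auto simp: openin_open)
  then show ?thesis
    by (auto intro!: sets.Int borel_closed closed_affine_hull)
qed

text \<open>For a face \<open>F\<close> of a closed convex cone \<open>C\<close>, this is the sum of
  the relative interior of \<open>F\<close> and the normal cone of \<open>C\<close> along
  \<open>F\<close>.\<close>

definition face_region :: "'a::euclidean_space set \<Rightarrow> 'a set \<Rightarrow> 'a set" where
  "face_region C F = {x. closest_point C x \<in> rel_interior F}"

lemma borel_face_region: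
  fixes C :: "'a::euclidean_space set"
  assumes "closed_convex_cone C"
  shows "face_region C F \<in> sets borel"
  using measurable_sets[OF borel_measurable_closest_point[OF assms] borel_rel_interior[of F]]
  by (simp add: face_region_def vimage_def)

text \<open>The residual is nonpositive on \<open>C\<close> and vanishes at \<open>p\<close>. From
  any \<open>y\<close> in \<open>F\<close> one can move slightly beyond the relative interior point
  \<open>p\<close> and stay in \<open>F\<close>, which forces the opposite sign at \<open>y\<close>;
  linearity extends this to the span.\<close>

lemma face_region_orthogonal:
  assumes C: "closed_convex_cone C" and F: "F face_of C" and x: "x \<in> face_region C F"
    and q: "q \<in> span F"
  shows "(x - closest_point C x) \<bullet> q = 0"
proof -
  define p where "p = closest_point C x"
  have p: "p \<in> rel_interior F"
    using x by (simp add: face_region_def p_def)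
  note cp = closest_point_cone[OF C, where x = x, folded p_def]
  have conv: "convex F"
    using F by (rule face_of_imp_convex)
  have "(x - p) \<bullet> y = 0" if y: "y \<in> F" for y
  proof -
    have "F \<noteq> {}" using y by auto
    then obtain e where e: "e > 1" "(1 - e) *\<^sub>R y + e *\<^sub>R p \<in> F"
      using convex_rel_interior_if[OF conv p] hull_inc[OF y, of affine]
      by (meson order_refl)
    then have "(x - p) \<bullet> ((1 - e) *\<^sub>R y + e *\<^sub>R p) \<le> 0"
      using cp(3) face_of_imp_subset[OF F] by blast
    then have "(e - 1) * ((x - p) \<bullet> y) \<ge> 0"
      using cp(2) by (simp add: inner_add_right left_diff_distrib)
    moreover have "(x - p) \<bullet> y \<le> 0"
      using cp(3) face_of_imp_subset[OF F] y by blast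
    ultimately show ?thesis
      using e(1) by (simp add: zero_le_mult_iff)
  qed
  then show ?thesis
    using orthogonal_to_span[of q F "x - p"] q by (simp add: orthogonal_def p_def)
qed

text \<open>Scaling \<open>p\<close> leaves the residual \<open>x - p\<close> unchanged, and the
  conditions of \<open>closest_point_cone_unique\<close> survive it; the relative interior of a
  conic face is itself closed under positive scaling.\<close>

lemma face_region_scaling:
  assumes C: "closed_convex_cone C" and F: "F face_of C" and x: "x \<in> face_region C F"
    and s: "s > 0"
  defines "p \<equiv> closest_point C x"
  shows "s *\<^sub>R p + (x - p) \<in> face_region C F"
    and "closest_point C (s *\<^sub>R p + (x - p)) = s *\<^sub>R p"
proof -
  note cp = closest_point_cone[OF C, where x = x, folded p_def]
  show eq: "closest_point C (s *\<^sub>R p + (x - p)) = s *\<^sub>R p"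
    using cp s closed_convex_coneD(5)[OF C]
    by (intro closest_point_cone_unique[OF C]) (auto simp: conic_def)
  have p: "p \<in> rel_interior F"
    using x by (simp add: face_region_def p_def)
  then have "conic F"
    using face_of_closed_convex_cone(1)[OF C F] rel_interior_subset by blast
  then have "(*\<^sub>R) s ` F = F"
    using s by (auto simp: conic_def image_iff intro!: bexI[of _ "(1 / s) *\<^sub>R _"])
  then have "s *\<^sub>R p \<in> rel_interior F"
    using rel_interior_scaleR[of s F] s p by auto
  then show "s *\<^sub>R p + (x - p) \<in> face_region C F"
    by (simp add: face_region_def eq)
qed

text \<open>The region of a face \<open>F\<close> is invariant under the map scaling \<open>span F\<close> by \<open>1 / t\<close> and fixing
  its orthogonal complement; on that region the map turns the Gaussian weight into the integrand.\<close>

lemma nn_integral_face_region: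
  fixes C :: "'a::euclidean_space set"
  assumes C: "closed_convex_cone C" and F: "F face_of C" and t: "0 < t" "t \<le> 1"
  shows "(\<integral>\<^sup>+x. ennreal (exp (- ((1 / t\<^sup>2 - 1) / 2 * (norm (closest_point C x))\<^sup>2)))
        * indicator (face_region C F) x \<partial>std_normal_vector_distribution) =
     ennreal (t ^ dim F) * emeasure std_normal_vector_distribution (face_region C F)"
proof -
  define h :: "'a \<Rightarrow> ennreal" where
    "h x = ennreal (exp (- ((1 / t\<^sup>2 - 1) / 2 * (norm (closest_point C x))\<^sup>2)))" for x
  define \<gamma> :: "'a \<Rightarrow> ennreal" where "\<gamma> x = ennreal (std_normal_vector_density x)" for x
  define A where "A = face_region C F"
  note [measurable] = borel_measurable_closest_point[OF C] borel_face_region[OF C, of F, folded A_def]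
  have [measurable]: "h \<in> borel_measurable borel" "\<gamma> \<in> borel_measurable borel"
    unfolding h_def \<gamma>_def by measurable
  obtain T where T: "linear T" "\<And>p. p \<in> span F \<Longrightarrow> T p = (1 / t) *\<^sub>R p"
    "\<And>w. (\<And>p. p \<in> span F \<Longrightarrow> w \<bullet> p = 0) \<Longrightarrow> T w = w"
    "\<And>f. f \<in> borel_measurable borel \<Longrightarrow>
       (\<integral>\<^sup>+x. f x \<partial>lborel) = ennreal ((1 / t) ^ dim (span F)) * (\<integral>\<^sup>+x. f (T x) \<partial>lborel)"
    using subspace_scaling[OF subspace_span, of "1 / t" F] t by auto
  have T_eq: "T x = (1 / t) *\<^sub>R closest_point C x + (x - closest_point C x)" if x: "x \<in> A" for x
  proof -
    have "closest_point C x \<in> span F"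
      using x rel_interior_subset by (auto simp: A_def face_region_def intro: span_base)
    moreover have "T (x - closest_point C x) = x - closest_point C x"
      using face_region_orthogonal[OF C F x[unfolded A_def]] by (intro T(3)) auto
    ultimately show ?thesis
      using linear_add[OF T(1), of "closest_point C x" "x - closest_point C x"] T(2) by simp
  qed
  have inj: "inj T"
    unfolding linear_injective_0[OF T(1)]
  proof (intro allI impI)
    fix x assume "T x = 0"
    obtain p w where pw: "p \<in> span F" "\<And>q. q \<in> span F \<Longrightarrow> orthogonal w q" "x = p + w"
      using orthogonal_subspace_decomp_exists[of F x] by metis
    have *: "(1 / t) *\<^sub>R p + w = 0"
      using \<open>T x = 0\<close> linear_add[OF T(1), of p w] T(2)[OF pw(1)] T(3)[of w] pw(2,3)
      by (simp add: orthogonal_def)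
    have "w \<bullet> p = 0"
      using pw(1,2) by (simp add: orthogonal_def)
    with * have "w = 0" "p = 0"
      using t by (metis add_cancel_right_left inner_eq_zero_iff inner_right_distrib inner_scaleR_right
          mult_zero_right inner_zero_right add_0 scaleR_eq_0_iff divide_eq_0_iff less_irrefl zero_neq_one)+
    then show "x = 0" by (simp add: pw(3))
  qed
  have TA: "T x \<in> A \<longleftrightarrow> x \<in> A" for x
  proof
    assume "x \<in> A"
    then show "T x \<in> A"
      using face_region_scaling(1)[OF C F, of x "1 / t"] t by (simp add: T_eq) (simp add: A_def)
  next
    assume Tx: "T x \<in> A"
    define y where "y = T x"
    \<comment> \<open>Scaling by \<open>t\<close> inverts \<open>T\<close> on the region;
      injectivity then identifies this preimage with \<open>x\<close>.\<close>
    define x' where "x' = t *\<^sub>R closest_point C y + (y - closest_point C y)"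
    have x': "x' \<in> A" "closest_point C x' = t *\<^sub>R closest_point C y"
      using face_region_scaling[OF C F, of y t] t Tx by (auto simp: A_def x'_def y_def)
    have "T x' = y"
      unfolding T_eq[OF x'(1)] x'(2) using t by (simp add: x'_def)
    then show "x \<in> A"
      using x'(1) inj by (simp add: y_def inj_eq)
  qed
  \<comment> \<open>By Pythagoras, the squared norms of \<open>T x\<close> and \<open>x\<close>
    differ by \<open>1 / t\<^sup>2 - 1\<close> times the squared norm of the projection, exactly
    what the exponential factor contributes.\<close>
  have pt: "h x * indicator A x * \<gamma> x = indicator A (T x) * \<gamma> (T x)" for x
  proof (cases "x \<in> A")
    case True
    define p where "p = closest_point C x"
    have "(x - p) \<bullet> p = 0"
      unfolding p_def by (rule closest_point_cone(2)[OF C])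
    then have "orthogonal p (x - p)"
      by (simp add: orthogonal_def inner_commute)
    then have n1: "(norm x)\<^sup>2 = (norm p)\<^sup>2 + (norm (x - p))\<^sup>2"
      and n2: "(norm (T x))\<^sup>2 = (1 / t)\<^sup>2 * (norm p)\<^sup>2 + (norm (x - p))\<^sup>2"
      using norm_add_Pythagorean[of p "x - p"] norm_add_Pythagorean[of "(1 / t) *\<^sub>R p" "x - p"]
      by (simp_all add: T_eq[OF True] orthogonal_clauses p_def[symmetric] power_mult_distrib power_divide)
    have "exp (- ((1 / t\<^sup>2 - 1) / 2 * (norm p)\<^sup>2)) * std_normal_vector_density x = std_normal_vector_density (T x)"
      unfolding std_normal_vector_density_eq n1 n2
      by (simp add: field_simps flip: exp_add)
    then show ?thesis
      using True by (simp add: TA h_def \<gamma>_def p_def ennreal_mult' [symmetric] std_normal_vector_density_pos less_imp_le)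
  qed (simp add: TA)
  have "(\<integral>\<^sup>+x. h x * indicator A x \<partial>std_normal_vector_distribution) = (\<integral>\<^sup>+x. h x * indicator A x * \<gamma> x \<partial>lborel)"
    unfolding std_normal_vector_distribution_def \<gamma>_def[symmetric]
    by (subst nn_integral_density) (auto simp: mult_ac)
  also have "\<dots> = (\<integral>\<^sup>+x. indicator A (T x) * \<gamma> (T x) \<partial>lborel)"
    by (simp only: pt)
  also have "\<dots> = ennreal (t ^ dim F) * (ennreal ((1 / t) ^ dim F) * (\<integral>\<^sup>+x. indicator A (T x) * \<gamma> (T x) \<partial>lborel))"
    using t by (simp add: mult.assoc[symmetric] ennreal_mult'[symmetric] power_mult_distrib[symmetric])
  also have "ennreal ((1 / t) ^ dim F) * (\<integral>\<^sup>+x. indicator A (T x) * \<gamma> (T x) \<partial>lborel) = (\<integral>\<^sup>+x. indicator A x * \<gamma> x \<partial>lborel)"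
    using T(4)[of "\<lambda>x. indicator A x * \<gamma> x"] by (simp add: dim_span)
  also have "\<dots> = emeasure std_normal_vector_distribution A"
    unfolding std_normal_vector_distribution_def \<gamma>_def[symmetric]
    by (subst emeasure_density) (auto simp: mult_ac)
  finally show ?thesis
    unfolding h_def A_def .
qed

subsection \<open>The Laplace transform of the squared projection norm\<close>

text \<open>The Laplace transform of \<open>\<parallel>\<Pi>\<^sub>C(g)\<parallel>\<^sup>2\<close>, parametrised so that for a polyhedral cone it is
  the polynomial in \<open>t\<close> whose coefficients are the intrinsic volumes.\<close>

definition projection_laplace :: "'a::euclidean_space set \<Rightarrow> real \<Rightarrow> real" where
  "projection_laplace C t =
     (\<integral>x. exp (- ((1 / t\<^sup>2 - 1) / 2 * (norm (closest_point C x))\<^sup>2)) \<partial>std_normal_vector_distribution)"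

lemma projection_laplace_exponent_nonneg:
  fixes t :: real
  assumes "0 < t" "t \<le> 1"
  shows "0 \<le> (1 / t\<^sup>2 - 1) / 2"
  using assms by (simp add: power_le_one)

lemma integrable_projection_laplace:
  fixes C :: "'a::euclidean_space set"
  assumes C: "closed_convex_cone C" and c: "c \<ge> 0"
  shows "integrable std_normal_vector_distribution (\<lambda>x. exp (- (c * (norm (closest_point C x))\<^sup>2)))"
proof -
  interpret prob_space "std_normal_vector_distribution :: 'a measure"
    by (rule prob_space_std_normal_vector_distribution)
  note [measurable] = borel_measurable_closest_point[OF C]
  show ?thesis
    using c by (intro integrable_const_bound[where B = 1]) auto
qed

lemma finite_faces_polyhedral_cone:
  "polyhedral_cone C \<Longrightarrow> finite {F. F face_of C}"
  by (intro finite_polyhedron_faces polyhedral_cone_imp_polyhedron)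

lemma disjoint_face_regions: "disjoint_family_on (face_region C) {F. F face_of C}"
  unfolding disjoint_family_on_def face_region_def using face_of_eq by blast

text \<open>Distinct faces have disjoint relative interiors, and a polyhedron has finitely many
  faces. The empty face has \<open>aff_dim\<close> -1 but \<open>dim\<close> 0, hence its explicit
  exclusion when \<open>dim\<close> replaces \<open>aff_dim\<close>.\<close>

lemma polyhedral_intrinsic_volume_eq_sum:
  fixes C :: "'a::euclidean_space set"
  assumes C: "polyhedral_cone C"
  shows "ennreal (polyhedral_intrinsic_volume k C) =
    (\<Sum>F\<in>{F. F face_of C \<and> F \<noteq> {} \<and> dim F = k}. emeasure std_normal_vector_distribution (face_region C F))"
proof -
  interpret prob_space "std_normal_vector_distribution :: 'a measure"
    by (rule prob_space_std_normal_vector_distribution)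
  define I where "I = {F. F face_of C \<and> F \<noteq> {} \<and> dim F = k}"
  note cone = polyhedral_cone_imp_closed_convex_cone[OF C]
  have "F face_of C \<and> aff_dim F = int k \<longleftrightarrow> F \<in> I" for F
    using face_of_closed_convex_cone(3)[OF cone, of F] by (cases "F = {}") (auto simp: I_def)
  then have "{x. \<exists>F. F face_of C \<and> aff_dim F = int k \<and> closest_point C x \<in> rel_interior F} =
      (\<Union>F\<in>I. face_region C F)"
    by (auto simp: face_region_def)
  then have "ennreal (polyhedral_intrinsic_volume k C) =
      emeasure std_normal_vector_distribution (\<Union>F\<in>I. face_region C F)"
    by (simp add: polyhedral_intrinsic_volume_def emeasure_eq_measure)
  also have "\<dots> = (\<Sum>F\<in>I. emeasure std_normal_vector_distribution (face_region C F))"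
  proof (rule sum_emeasure[symmetric])
    show "finite I"
      by (rule finite_subset[OF _ finite_faces_polyhedral_cone[OF C]]) (auto simp: I_def)
    show "disjoint_family_on (face_region C) I"
      by (rule disjoint_family_on_mono[OF _ disjoint_face_regions]) (auto simp: I_def)
  qed (use borel_face_region[OF cone] in auto)
  finally show ?thesis unfolding I_def .
qed

text \<open>The face regions partition the space; each contributes its Gaussian measure times
  \<open>t ^ dim F\<close> by \<open>nn_integral_face_region\<close>, and grouping by dimension
  yields the coefficients.\<close>

lemma projection_laplace_polyhedral:
  fixes C :: "'a::euclidean_space set"
  assumes C: "polyhedral_cone C" and t: "0 < t" "t \<le> 1"
  shows "projection_laplace C t = (\<Sum>k\<le>DIM('a). polyhedral_intrinsic_volume k C * t ^ k)"
proof -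
  let ?N = "std_normal_vector_distribution :: 'a measure"
  define h where "h x = exp (- ((1 / t\<^sup>2 - 1) / 2 * (norm (closest_point C x))\<^sup>2))" for x
  define I where "I = {F. F face_of C \<and> F \<noteq> {}}"
  note cone = polyhedral_cone_imp_closed_convex_cone[OF C]
  note [measurable] = borel_measurable_closest_point[OF cone] borel_face_region[OF cone]
  have [measurable]: "h \<in> borel_measurable borel"
    unfolding h_def by measurable
  have finI: "finite I"
    by (rule finite_subset[OF _ finite_faces_polyhedral_cone[OF C]]) (auto simp: I_def)
  have disj: "disjoint_family_on (face_region C) I"
    by (rule disjoint_family_on_mono[OF _ disjoint_face_regions]) (auto simp: I_def)
  have cover: "(\<Union>F\<in>I. face_region C F) = UNIV"
  proof -
    have "\<exists>F\<in>I. x \<in> face_region C F" for x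
    proof -
      obtain F where "F face_of C" "closest_point C x \<in> rel_interior F"
        using ex_face_of_rel_interior[OF closed_convex_coneD(2)[OF cone] closest_point_cone(1)[OF cone]] .
      then show ?thesis
        by (intro bexI[of _ F]) (auto simp: I_def face_region_def)
    qed
    then show ?thesis by auto
  qed
  have "ennreal (projection_laplace C t) = (\<integral>\<^sup>+x. ennreal (h x) \<partial>?N)"
    unfolding projection_laplace_def h_def
    by (intro nn_integral_eq_integral[symmetric] integrable_projection_laplace cone
        projection_laplace_exponent_nonneg t) auto
  also have "\<dots> = (\<integral>\<^sup>+x. (\<Sum>F\<in>I. ennreal (h x) * indicator (face_region C F) x) \<partial>?N)"
    by (simp add: sum_distrib_left[symmetric] indicator_UN_disjoint[OF finI disj, symmetric] cover)
  also have "\<dots> = (\<Sum>F\<in>I. \<integral>\<^sup>+x. ennreal (h x) * indicator (face_region C F) x \<partial>?N)"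
    by (intro nn_integral_sum) auto
  also have "\<dots> = (\<Sum>F\<in>I. ennreal (t ^ dim F) * emeasure ?N (face_region C F))"
    unfolding h_def using nn_integral_face_region[OF cone _ t] by (intro sum.cong) (auto simp: I_def)
  also have "\<dots> = (\<Sum>k\<le>DIM('a). \<Sum>F\<in>{F \<in> I. dim F = k}. ennreal (t ^ dim F) * emeasure ?N (face_region C F))"
    by (intro sum.group[symmetric] finI) (auto simp: dim_subset_UNIV)
  also have "\<dots> = (\<Sum>k\<le>DIM('a). ennreal (polyhedral_intrinsic_volume k C * t ^ k))"
  proof (rule sum.cong[OF refl])
    fix k
    have "{F \<in> I. dim F = k} = {F. F face_of C \<and> F \<noteq> {} \<and> dim F = k}"
      by (auto simp: I_def)
    then have vol: "ennreal (polyhedral_intrinsic_volume k C) =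
        (\<Sum>F\<in>{F \<in> I. dim F = k}. emeasure ?N (face_region C F))"
      by (simp add: polyhedral_intrinsic_volume_eq_sum[OF C])
    have "ennreal (polyhedral_intrinsic_volume k C * t ^ k) =
        ennreal (t ^ k) * ennreal (polyhedral_intrinsic_volume k C)"
      using t by (simp add: ennreal_mult'' mult.commute)
    also have "\<dots> = (\<Sum>F\<in>{F \<in> I. dim F = k}. ennreal (t ^ dim F) * emeasure ?N (face_region C F))"
      unfolding vol sum_distrib_left by (intro sum.cong) auto
    finally show "(\<Sum>F\<in>{F \<in> I. dim F = k}. ennreal (t ^ dim F) * emeasure ?N (face_region C F)) =
        ennreal (polyhedral_intrinsic_volume k C * t ^ k)" ..
  qed
  also have "\<dots> = ennreal (\<Sum>k\<le>DIM('a). polyhedral_intrinsic_volume k C * t ^ k)"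
    using t by (intro sum_ennreal) (auto simp: polyhedral_intrinsic_volume_def)
  finally show ?thesis
    using t by (subst (asm) ennreal_inj)
      (auto simp: projection_laplace_def polyhedral_intrinsic_volume_def intro!: sum_nonneg)
qed

text \<open>For \<open>t \<le> 1\<close> the exponent is nonpositive, so the constant 1 dominates;
  pointwise convergence is continuity of the projection norm.\<close>

lemma projection_laplace_tendsto:
  fixes C :: "'a::euclidean_space set" and D :: "nat \<Rightarrow> 'a set"
  assumes C: "closed_convex_cone C" and D: "\<And>i. closed_convex_cone (D i)"
    and lim: "(\<lambda>i. conic_hausdorff_distance (D i) C) \<longlonglongrightarrow> 0" and t: "0 < t" "t \<le> 1"
  shows "(\<lambda>i. projection_laplace (D i) t) \<longlonglongrightarrow> projection_laplace C t"
  unfolding projection_laplace_def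
proof (rule integral_dominated_convergence[where w = "\<lambda>_. 1"])
  interpret prob_space "std_normal_vector_distribution :: 'a measure"
    by (rule prob_space_std_normal_vector_distribution)
  note nonneg = projection_laplace_exponent_nonneg[OF t]
  show "integrable (std_normal_vector_distribution :: 'a measure) (\<lambda>_. 1 :: real)"
    by simp
  show "AE x in std_normal_vector_distribution.
      (\<lambda>i. exp (- ((1 / t\<^sup>2 - 1) / 2 * (norm (closest_point (D i) x))\<^sup>2)))
        \<longlonglongrightarrow> exp (- ((1 / t\<^sup>2 - 1) / 2 * (norm (closest_point C x))\<^sup>2))"
    by (intro AE_I2 tendsto_intros norm_closest_point_cone_tendsto C D lim)
  show "AE x in std_normal_vector_distribution.
      norm (exp (- ((1 / t\<^sup>2 - 1) / 2 * (norm (closest_point (D i) x))\<^sup>2))) \<le> 1" for i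
    using nonneg by (intro AE_I2) (simp add: mult_nonneg_nonneg)
qed (use integrable_projection_laplace[OF C projection_laplace_exponent_nonneg[OF t]]
    integrable_projection_laplace[OF D projection_laplace_exponent_nonneg[OF t]] in
    \<open>auto dest: borel_measurable_integrable\<close>)

text \<open>Lagrange interpolation: \<open>w j k\<close> is the coefficient of \<open>X\<^sup>k\<close> in the \<open>j\<close>-th basis polynomial.\<close>

lemma interpolation_coefficients:
  fixes x :: "nat \<Rightarrow> 'a::field"
  assumes inj: "inj_on x {..d}"
  obtains w :: "nat \<Rightarrow> nat \<Rightarrow> 'a"
  where "\<And>a k. k \<le> d \<Longrightarrow> (\<Sum>j\<le>d. w j k * (\<Sum>i\<le>d. a i * x j ^ i)) = a k"
proof -
  define L where "L j = smult (inverse (\<Prod>m\<in>{..d} - {j}. x j - x m)) (\<Prod>m\<in>{..d} - {j}. [:- x m, 1:])" for j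
  have deg_L: "degree (L j) \<le> d" if "j \<le> d" for j
  proof -
    have "degree (\<Prod>m\<in>{..d} - {j}. [:- x m, 1:]) \<le> (\<Sum>m\<in>{..d} - {j}. degree [:- x m, 1:])"
      by (rule degree_prod_sum_le[unfolded o_def]) simp
    also have "\<dots> = d"
      using that by simp
    finally show ?thesis
      unfolding L_def using degree_smult_le order_trans by blast
  qed
  have poly_L: "poly (L j) (x i) = (if i = j then 1 else 0)" if "i \<le> d" "j \<le> d" for i j
  proof (cases "i = j")
    case True
    have "(\<Prod>m\<in>{..d} - {j}. x j - x m) \<noteq> 0"
      using inj that by (auto dest: inj_onD)
    then show ?thesis
      using True by (simp add: L_def poly_prod)
  next
    case False
    then have "(\<Prod>m\<in>{..d} - {j}. x i - x m) = 0"
      using that by (intro prod_zero) auto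
    then show ?thesis
      using False by (simp add: L_def poly_prod)
  qed
  have "(\<Sum>j\<le>d. coeff (L j) k * (\<Sum>i\<le>d. a i * x j ^ i)) = a k" if k: "k \<le> d" for a k
  proof -
    define p where "p = (\<Sum>i\<le>d. monom (a i) i)"
    have poly_p: "poly p z = (\<Sum>i\<le>d. a i * z ^ i)" for z
      by (simp add: p_def poly_sum poly_monom)
    \<comment> \<open>The Lagrange interpolant of \<open>p\<close>: both have degree at most
      \<open>d\<close> and agree at \<open>d + 1\<close> distinct nodes, so their coefficients
      coincide.\<close>
    define q where "q = (\<Sum>j\<le>d. smult (poly p (x j)) (L j))"
    have "p = q"
    proof (rule poly_eqI_degree[of "x ` {..d}"])
      fix z assume "z \<in> x ` {..d}"
      then obtain i where i: "i \<le> d" "z = x i" by auto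
      have "poly q z = (\<Sum>j\<le>d. if i = j then poly p (x j) else 0)"
        unfolding q_def poly_sum using i by (intro sum.cong) (auto simp: poly_L)
      then show "poly p z = poly q z"
        using i by simp
    next
      have "degree p \<le> d"
        unfolding p_def by (intro degree_sum_le) (auto intro: order_trans[OF degree_monom_le])
      moreover have "degree q \<le> d"
        unfolding q_def by (intro degree_sum_le) (auto intro: order_trans[OF degree_smult_le] deg_L)
      ultimately show "degree p < card (x ` {..d})" "degree q < card (x ` {..d})"
        by (simp_all add: card_image[OF inj])
    qed
    then have "coeff p k = coeff q k"
      by (rule arg_cong)
    also have "\<dots> = (\<Sum>j\<le>d. coeff (L j) k * poly p (x j))"
      by (simp add: q_def coeff_sum mult.commute)
    finally have "coeff p k = (\<Sum>j\<le>d. coeff (L j) k * poly p (x j))" .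
    moreover have "coeff p k = a k"
      using k by (simp add: p_def coeff_sum)
    ultimately show ?thesis
      by (simp add: poly_p)
  qed
  then show ?thesis by (rule that)
qed

text \<open>Interpolation at \<open>d + 1\<close> nodes turns convergence of the Laplace transforms into convergence
  of the intrinsic volumes, so the limit defining \<open>intrinsic_volume\<close> exists.\<close>

lemma projection_laplace_eq_sum:
  fixes C :: "'a::euclidean_space set"
  assumes C: "closed_convex_cone C" and t: "0 < t" "t \<le> 1"
  shows "projection_laplace C t = (\<Sum>k\<le>DIM('a). intrinsic_volume k C * t ^ k)"
proof (cases "polyhedral_cone C")
  case True
  then show ?thesis
    using projection_laplace_polyhedral[OF True t] by (simp add: intrinsic_volume_def)
next
  case False
  \<comment> \<open>Distinct nodes in the half-open interval from 0 to 1 where the polynomial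
    identity holds.\<close>
  define x where "x j = inverse (real (Suc j))" for j
  have x: "0 < x j" "x j \<le> 1" for j
    by (simp_all add: x_def inverse_le_1_iff)
  have "inj_on x {..DIM('a)}"
    by (auto simp: inj_on_def x_def)
  then obtain w where w:
    "\<And>a k. k \<le> DIM('a) \<Longrightarrow> (\<Sum>j\<le>DIM('a). w j k * (\<Sum>i\<le>DIM('a). a i * x j ^ i)) = a k"
    using interpolation_coefficients[of x "DIM('a)"] by metis
  define v where "v k = (\<Sum>j\<le>DIM('a). w j k * projection_laplace C (x j))" for k
  have lim: "(\<lambda>i. polyhedral_intrinsic_volume k (D i)) \<longlonglongrightarrow> v k"
    if D: "\<forall>i. polyhedral_cone (D i)" "(\<lambda>i. conic_hausdorff_distance (D i) C) \<longlonglongrightarrow> 0"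
      and k: "k \<le> DIM('a)" for D k
  proof -
    have "(\<lambda>i. \<Sum>j\<le>DIM('a). w j k * projection_laplace (D i) (x j)) \<longlonglongrightarrow> v k"
      unfolding v_def using D polyhedral_cone_imp_closed_convex_cone
      by (intro tendsto_sum tendsto_mult tendsto_const projection_laplace_tendsto C x) auto
    moreover have "(\<Sum>j\<le>DIM('a). w j k * projection_laplace (D i) (x j)) = polyhedral_intrinsic_volume k (D i)" for i
      using w[OF k, of "\<lambda>k. polyhedral_intrinsic_volume k (D i)"] D(1)
      by (simp add: projection_laplace_polyhedral x)
    ultimately show ?thesis by simp
  qed
  \<comment> \<open>Without an approximating sequence every number would meet the description under
    \<open>THE\<close>; its existence gives uniqueness.\<close>
  obtain D where D: "\<And>i. polyhedral_cone (D i)" "(\<lambda>i. conic_hausdorff_distance (D i) C) \<longlonglongrightarrow> 0"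
    using polyhedral_approximation[OF C] by metis
  have iv: "intrinsic_volume k C = v k" if k: "k \<le> DIM('a)" for k
    unfolding intrinsic_volume_def if_not_P[OF False]
  proof (rule the_equality)
    fix v' assume "\<forall>D. (\<forall>i. polyhedral_cone (D i)) \<and> (\<lambda>i. conic_hausdorff_distance (D i) C) \<longlonglongrightarrow> 0 \<longrightarrow>
      (\<lambda>i. polyhedral_intrinsic_volume k (D i)) \<longlonglongrightarrow> v'"
    then show "v' = v k"
      using D lim[of D k] k LIMSEQ_unique by blast
  qed (use lim k in blast)
  have "(\<lambda>i. projection_laplace (D i) t) \<longlonglongrightarrow> projection_laplace C t"
    using D polyhedral_cone_imp_closed_convex_cone by (intro projection_laplace_tendsto C t) auto
  moreover have "(\<lambda>i. projection_laplace (D i) t) \<longlonglongrightarrow> (\<Sum>k\<le>DIM('a). v k * t ^ k)"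
    unfolding projection_laplace_polyhedral[OF D(1) t]
    using lim D by (intro tendsto_sum tendsto_mult tendsto_const) auto
  ultimately show ?thesis
    using LIMSEQ_unique by (simp add: iv)
qed

subsection \<open>The statistical dimension\<close>

text \<open>The derivative of the exponential at 0, read along the null sequence \<open>y\<close>.
  The case \<open>r = 0\<close> is split off because it would divide by zero.\<close>

lemma scaled_one_minus_exp_tendsto:
  fixes r :: real
  shows "(\<lambda>n. 2 ^ Suc n * (1 - exp (- (r / 2 ^ Suc n)))) \<longlonglongrightarrow> r"
proof (cases "r = 0")
  case False
  define y where "y n = - (r / 2 ^ Suc n)" for n
  have "(\<lambda>h. (exp h - 1) / h) \<midarrow>0\<rightarrow> (1 :: real)"
    using DERIV_exp[of "0 :: real"] by (simp add: DERIV_def)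
  moreover have "y \<longlonglongrightarrow> 0"
  proof -
    have "(\<lambda>n. - r * (1 / 2) ^ Suc n) \<longlonglongrightarrow> - r * 0"
      by (intro tendsto_mult tendsto_const LIMSEQ_Suc LIMSEQ_realpow_zero) simp_all
    then show ?thesis
      by (simp add: y_def[abs_def] power_one_over)
  qed
  ultimately have "(\<lambda>n. (exp (y n) - 1) / y n) \<longlonglongrightarrow> 1"
    by (rule filterlim_compose[OF _ filterlim_atI]) (use False in \<open>simp add: y_def\<close>)
  then have "(\<lambda>n. r * ((exp (y n) - 1) / y n)) \<longlonglongrightarrow> r * 1"
    by (intro tendsto_mult tendsto_const)
  moreover have "r * ((a - 1) / - (r / c)) = c * (1 - a)" if "c > 0" for a c :: real
    using False that by (simp add: field_simps)
  then have "r * ((exp (y n) - 1) / y n) = 2 ^ Suc n * (1 - exp (- (r / 2 ^ Suc n)))" for n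
    unfolding y_def by (metis zero_less_numeral zero_less_power)
  ultimately show ?thesis
    by simp
qed simp

text \<open>Scaling by powers of two makes each exponential the square of its successor
  \<open>q\<close>, so the claim reduces to nonnegativity of the square of
  \<open>1 - q\<close>.\<close>

lemma scaled_one_minus_exp_mono:
  fixes r :: real
  shows "mono (\<lambda>n. 2 ^ Suc n * (1 - exp (- (r / 2 ^ Suc n))))"
proof (rule incseq_SucI)
  fix n
  define q where "q = exp (- (r / 2 ^ Suc (Suc n)))"
  have "exp (- (r / 2 ^ Suc n)) = q\<^sup>2"
    by (simp add: q_def power2_eq_square field_simps flip: exp_add)
  moreover have "1 - q\<^sup>2 \<le> 2 * (1 - q)"
    using zero_le_power2[of "1 - q"] by (simp add: power2_diff)
  then have "2 ^ Suc n * (1 - q\<^sup>2) \<le> 2 ^ Suc n * (2 * (1 - q))"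
    by (intro mult_left_mono) auto
  ultimately show "2 ^ Suc n * (1 - exp (- (r / 2 ^ Suc n))) \<le>
      2 ^ Suc (Suc n) * (1 - exp (- (r / 2 ^ Suc (Suc n))))"
    by (simp add: q_def)
qed

text \<open>For the base \<open>t n\<close>, the relation
  \<open>1 / (t n)\<^sup>2 = 1 + 1 / 2 ^ n\<close> rewrites \<open>2 ^ Suc n * (1 - t n)\<close> as
  a quotient tending to 1; the remaining geometric sum has \<open>k\<close> terms, each tending to
  1.\<close>

lemma scaled_one_minus_power_tendsto:
  "(\<lambda>n. 2 ^ Suc n * (1 - (1 / sqrt (1 + 1 / 2 ^ n)) ^ k)) \<longlonglongrightarrow> real k"
proof -
  define t :: "nat \<Rightarrow> real" where "t n = 1 / sqrt (1 + 1 / 2 ^ n)" for n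
  have "(\<lambda>n. 1 / 2 ^ n :: real) \<longlonglongrightarrow> 0"
    using LIMSEQ_realpow_zero[of "1 / 2 :: real"] by (simp add: power_one_over)
  then have "t \<longlonglongrightarrow> 1 / sqrt (1 + 0)"
    unfolding t_def by (intro tendsto_intros) simp_all
  then have t1: "t \<longlonglongrightarrow> 1" by simp
  have "2 ^ Suc n * (1 - t n ^ k) = 2 * (t n)\<^sup>2 / (1 + t n) * (\<Sum>i<k. t n ^ i)" for n
  proof -
    have pos: "t n > 0" by (simp add: t_def add_pos_pos)
    have "(t n)\<^sup>2 * (1 + 1 / 2 ^ n) = 1"
      by (simp add: t_def power_divide add_pos_pos less_imp_le)
        (simp add: field_simps add_pos_pos less_imp_neq[symmetric])
    then have "(t n)\<^sup>2 = 2 ^ n * ((1 - t n) * (1 + t n))"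
      by (simp add: field_simps power2_eq_square)
    then have "2 * (t n)\<^sup>2 / (1 + t n) = 2 ^ Suc n * (1 - t n)"
      using pos by (simp add: field_simps)
    then show ?thesis
      by (simp add: one_diff_power_eq)
  qed
  moreover have "(\<lambda>n. 2 * (t n)\<^sup>2 / (1 + t n) * (\<Sum>i<k. t n ^ i)) \<longlonglongrightarrow> 2 * 1\<^sup>2 / (1 + 1) * (\<Sum>i<k. 1 ^ i)"
    by (intro tendsto_intros t1) auto
  ultimately show ?thesis
    by (simp add: t_def)
qed

lemma statistical_dimension_eq_integral:
  fixes C :: "'a::euclidean_space set"
  assumes C: "closed_convex_cone C"
  shows "statistical_dimension C =
    (\<integral>x. (norm (closest_point C x))\<^sup>2 \<partial>std_normal_vector_distribution)"
proof -
  interpret prob_space "std_normal_vector_distribution :: 'a measure"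
    by (rule prob_space_std_normal_vector_distribution)
  have prob_UNIV: "prob UNIV = 1"
    using prob_space by simp
  let ?N = "std_normal_vector_distribution :: 'a measure"
  define R where "R x = (norm (closest_point C x))\<^sup>2" for x
  define f where "f n x = 2 ^ Suc n * (1 - exp (- (R x / 2 ^ Suc n)))" for n x
  \<comment> \<open>This is the parameter \<open>\<lambda> = 1 / 2 ^ n\<close>; its half is the
    factor on \<open>R x\<close> in the exponent of \<open>f n x\<close>.\<close>
  define t :: "nat \<Rightarrow> real" where "t n = 1 / sqrt (1 + 1 / 2 ^ n)" for n
  have t: "0 < t n" "t n \<le> 1" for n
    by (simp_all add: t_def add_pos_pos)
  have t2: "1 / (t n)\<^sup>2 - 1 = 1 / 2 ^ n" for n
    by (simp add: t_def power_divide add_pos_pos less_imp_le)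
  have f_eq: "f n = (\<lambda>x. 2 ^ Suc n * (1 - exp (- ((1 / (t n)\<^sup>2 - 1) / 2 * (norm (closest_point C x))\<^sup>2))))" for n
    by (simp add: f_def R_def t2 fun_eq_iff)
  have int: "integrable ?N (\<lambda>x. exp (- ((1 / (t n)\<^sup>2 - 1) / 2 * (norm (closest_point C x))\<^sup>2)))" for n
    by (intro integrable_projection_laplace C projection_laplace_exponent_nonneg t)
  have "projection_laplace C 1 = 1"
    by (simp add: projection_laplace_def prob_UNIV)
  \<comment> \<open>At \<open>t = 1\<close> the exponent vanishes, so the polynomial identity
    becomes the total mass.\<close>
  then have total: "(\<Sum>k\<le>DIM('a). intrinsic_volume k C) = 1"
    using projection_laplace_eq_sum[OF C, of 1] by simp
  have one_minus: "1 - projection_laplace C (t n) = (\<Sum>k\<le>DIM('a). intrinsic_volume k C * (1 - t n ^ k))" for n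
    unfolding projection_laplace_eq_sum[OF C t] right_diff_distrib sum_subtractf mult_1_right total ..
  have "integral\<^sup>L ?N (f n) = 2 ^ Suc n * (1 - projection_laplace C (t n))" for n
    using int[of n] by (simp add: f_eq projection_laplace_def prob_UNIV)
  also have "2 ^ Suc n * (1 - projection_laplace C (t n)) =
      (\<Sum>k\<le>DIM('a). intrinsic_volume k C * (2 ^ Suc n * (1 - t n ^ k)))" for n
    unfolding one_minus sum_distrib_left by (intro sum.cong refl mult.left_commute)
  finally have int_f: "integral\<^sup>L ?N (f n) =
      (\<Sum>k\<le>DIM('a). intrinsic_volume k C * (2 ^ Suc n * (1 - t n ^ k)))" for n .
  have "(\<lambda>n. integral\<^sup>L ?N (f n)) \<longlonglongrightarrow> (\<Sum>k\<le>DIM('a). intrinsic_volume k C * real k)"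
    unfolding int_f t_def
    by (intro scaled_one_minus_power_tendsto tendsto_sum tendsto_mult[OF tendsto_const])
  \<comment> \<open>The integrals of the increasing \<open>f n\<close> converge to a finite limit,
    so monotone convergence evaluates the integral of \<open>R\<close> from measurability of
    \<open>R\<close> alone.\<close>
  then have "integral\<^sup>L ?N R = (\<Sum>k\<le>DIM('a). intrinsic_volume k C * real k)"
  proof (rule integral_monotone_convergence[rotated 3])
    show "integrable ?N (f n)" for n
      unfolding f_eq using int[of n] by simp
    show "R \<in> borel_measurable ?N"
      unfolding R_def using borel_measurable_closest_point[OF C] by measurable
    show "AE x in ?N. mono (\<lambda>n. f n x)" "AE x in ?N. (\<lambda>n. f n x) \<longlonglongrightarrow> R x"
      unfolding f_def by (intro AE_I2 scaled_one_minus_exp_mono scaled_one_minus_exp_tendsto)+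
  qed
  then show ?thesis
    by (simp add: statistical_dimension_def R_def[abs_def] atMost_atLeast0 mult.commute)
qed

theorem proposition2p4:
  fixes C :: "(real ^ 'd) set" and M :: "'w measure" and g :: "'w \<Rightarrow> real ^ 'd"
  assumes "closed_convex_cone C"
    and "prob_space M"
    and "distributed M lborel g (\<lambda>x. ennreal (std_normal_vector_density x))"
  shows "statistical_dimension C = prob_space.expectation M (\<lambda>\<omega>. (norm (closest_point C (g \<omega>)))\<^sup>2)"
proof -
  have distr: "distr M lborel g = std_normal_vector_distribution"
    unfolding std_normal_vector_distribution_def by (rule distributed_distr_eq_density[OF assms(3)])
  have [measurable]: "g \<in> measurable M lborel"
    using assms(3) by (rule distributed_measurable)
  note [measurable] = borel_measurable_closest_point[OF assms(1)]
  show ?thesis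
    unfolding statistical_dimension_eq_integral[OF assms(1)] distr[symmetric]
    by (rule integral_distr) measurable
qed

end
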